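(* Let $f,g\in L^2(\mathbb{R})$ be complex-valued, and let $$F_1(\lambda)=\int_{\mathbb{R}}\overline{f(x)}\,g(\lambda x)\,dx,\qquad F_2(\lambda)=\int_{\mathbb{R}}\overline{g(x)}\,f(\lambda x)\,dx,\qquad \lambda\in\mathbb{R}^\times.$$ Suppose that both $F_1$ and $F_2$ have holomorphic extensions to $\mathbb{D}$ (denoted by the same symbols) such that $$\int_{\mathbb{D}}|F_j(\lambda)|^2\,|\lambda^2+1|\,dA(\lambda)<+\infty,\qquad j=1,2.$$ Suppose, moreover, that one of the functions, say $F_1$, has a holomorphic extension to a neighborhood of $\bar{\mathbb{D}}\setminus\{i,-i\}$. Then: (a) there are constants $c_1,c_2\in\mathbb{C}$ with $c_2=\overline{c_1}$ such that $F_j(\lambda)=c_j(1+\lambda^2)^{-1/2}$ for all $\lambda\in\mathbb{R}^\times$ and $j=1,2$; and (b) if, in addition, $c_1=0$, then $F_1\equiv F_2\equiv 0$.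
   Context: $\mathbb{R}^\times=\mathbb{R}\setminus\{0\}$. $\mathbb{D}=\{z\in\mathbb{C}:|z|<1\}$ is the open unit disk, $\bar{\mathbb{D}}$ is its closure, and $dA$ is the area element in $\mathbb{C}$. That a function $F_j$ on $\mathbb{R}^\times$ has a holomorphic extension to an open set $U\subset\mathbb{C}$ means that there is a holomorphic function on $U$ which coincides with $F_j$ on $U\cap\mathbb{R}^\times$; an extension to a neighborhood of $\bar{\mathbb{D}}\setminus\{i,-i\}$ means an extension to some open set containing $\bar{\mathbb{D}}\setminus\{i,-i\}$. *)

theory Defs
  imports "HOL-Complex_Analysis.Complex_Analysis"
begin

text \<open>
  Representatives of elements of $L^2(R)$; equality almost everywhere is not quotiented out.
\<close>

definition square_integrable :: "(real \<Rightarrow> complex) \<Rightarrow> bool" where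
  "square_integrable f \<longleftrightarrow>
     f \<in> borel_measurable lebesgue \<and> integrable lebesgue (\<lambda>x. (norm (f x))\<^sup>2)"

text \<open>
  Only the values at \<open>t \<noteq> 0\<close> are meaningful; \<open>t = 0\<close> is excluded
  wherever this function is used.
\<close>

definition dilation_product :: "(real \<Rightarrow> complex) \<Rightarrow> (real \<Rightarrow> complex) \<Rightarrow> real \<Rightarrow> complex" where
  "dilation_product f g t = (\<integral>x. cnj (f x) * g (t * x) \<partial>lebesgue)"

text \<open>
  \<open>G\<close> is a holomorphic extension to the open set \<open>U\<close> of a function \<open>F\<close> on the nonzero reals.
\<close>

definition holomorphic_extension ::
    "(real \<Rightarrow> complex) \<Rightarrow> complex set \<Rightarrow> (complex \<Rightarrow> complex) \<Rightarrow> bool" where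
  "holomorphic_extension F U G \<longleftrightarrow>
     open U \<and> G holomorphic_on U \<and>
     (\<forall>t. t \<noteq> 0 \<and> complex_of_real t \<in> U \<longrightarrow> G (complex_of_real t) = F t)"

end

theory Submission
  imports Defs
begin

text \<open>
  Substitution gives \<open>F1 t = cnj (F2 (1 / t)) / \<bar>t\<bar>\<close>. Hence the continuation of \<open>F1\<close> across the
  right unit semicircle is \<open>cnj (F2 (cnj (1 / z))) / z\<close>, and across the left one it is the
  negative of this. The branch of \<open>sqrt (1 + z\<^sup>2)\<close> in the disk shows the same change of sign when
  compared with \<open>z * sqrt (1 + 1 / z\<^sup>2)\<close> outside, so \<open>F1 z * sqrt (1 + z\<^sup>2)\<close> extends to a
  single-valued holomorphic function on the Riemann sphere without \<open>\<plusminus>\<i>\<close>. By the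
  area mean value inequality the two integrability conditions bound it by a multiple of
  \<open>1 / \<bar>1 - \<bar>z\<bar>\<bar>\<close> near \<open>\<plusminus>\<i>\<close>, which excludes essential singularities, and make it
  \<open>o(1 / \<bar>z \<mp> \<i>\<bar>)\<close> radially, which excludes poles. So it is constant by Liouville's theorem.
\<close>

section \<open>Area mean values of holomorphic functions\<close>

lemma measurable_Complex [measurable]:
  "(\<lambda>(x, y). Complex x y) \<in> borel_measurable (lborel \<Otimes>\<^sub>M lborel)"
  by (subst measurable_cong_sets[where M' = "borel" and N' = borel])
     (auto simp: borel_prod[symmetric] case_prod_unfold Complex_eq
       intro!: borel_measurable_continuous_onI continuous_intros)

text \<open>Lebesgue measure is determined by its values on boxes, and the preimage of a box under
  \<open>Complex\<close> is a rectangle. This makes Tonelli's theorem available for integrals over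
  the complex plane.\<close>

lemma lborel_complex_eq_distr:
  "distr (lborel \<Otimes>\<^sub>M lborel) borel (\<lambda>(x, y). Complex x y) = (lborel :: complex measure)"
proof (rule lborel_eqI[symmetric])
  fix l u :: complex
  assume "\<And>b. b \<in> Basis \<Longrightarrow> l \<bullet> b \<le> u \<bullet> b"
  from this[of 1] this[of \<i>] have le: "Re l \<le> Re u" "Im l \<le> Im u"
    by (auto simp: Basis_complex_def)
  have vim: "(\<lambda>(x, y). Complex x y) -` box l u \<inter> space (lborel \<Otimes>\<^sub>M lborel)
      = {Re l<..<Re u} \<times> {Im l<..<Im u}"
    by (auto simp: box_def Basis_complex_def space_pair_measure)
  show "emeasure (distr (lborel \<Otimes>\<^sub>M lborel) borel (\<lambda>(x, y). Complex x y)) (box l u)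
      = (\<Prod>b\<in>Basis. (u - l) \<bullet> b)"
    by (subst emeasure_distr)
       (use le in \<open>auto simp: vim lborel.emeasure_pair_measure_Times Basis_complex_def
          ennreal_mult\<close>)
qed simp

lemma nn_integral_complex_iterated:
  fixes f :: "complex \<Rightarrow> ennreal"
  assumes [measurable]: "f \<in> borel_measurable borel"
  shows "(\<integral>\<^sup>+z. f z \<partial>lborel) = (\<integral>\<^sup>+x. \<integral>\<^sup>+y. f (Complex x y) \<partial>lborel \<partial>lborel)"
    and "(\<integral>\<^sup>+z. f z \<partial>lborel) = (\<integral>\<^sup>+y. \<integral>\<^sup>+x. f (Complex x y) \<partial>lborel \<partial>lborel)"
proof -
  have *: "(\<lambda>p. f (case p of (x, y) \<Rightarrow> Complex x y)) \<in> borel_measurable (lborel \<Otimes>\<^sub>M lborel)"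
    by measurable
  have "(\<integral>\<^sup>+z. f z \<partial>lborel) = (\<integral>\<^sup>+p. f (case p of (x, y) \<Rightarrow> Complex x y) \<partial>(lborel \<Otimes>\<^sub>M lborel))"
    by (subst lborel_complex_eq_distr[symmetric]) (simp add: nn_integral_distr)
  with lborel.nn_integral_fst[OF *] lborel_pair.nn_integral_snd[OF *]
  show "(\<integral>\<^sup>+z. f z \<partial>lborel) = (\<integral>\<^sup>+x. \<integral>\<^sup>+y. f (Complex x y) \<partial>lborel \<partial>lborel)"
    and "(\<integral>\<^sup>+z. f z \<partial>lborel) = (\<integral>\<^sup>+y. \<integral>\<^sup>+x. f (Complex x y) \<partial>lborel \<partial>lborel)"
    by simp_all
qed

text \<open>On every horizontal line the shear is a translation, so it disappears when the integral
  over the real part is taken first.\<close>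

lemma nn_integral_complex_shear_Re:
  fixes f :: "complex \<Rightarrow> ennreal"
  assumes [measurable]: "f \<in> borel_measurable borel"
  shows "(\<integral>\<^sup>+z. f (z + of_real (a * Im z)) \<partial>lborel) = (\<integral>\<^sup>+z. f z \<partial>lborel)"
proof -
  have "(\<integral>\<^sup>+x. f (Complex x y) \<partial>lborel) = (\<integral>\<^sup>+x. f (Complex (x + a * y) y) \<partial>lborel)" for y
    using nn_integral_real_affine[of "\<lambda>x. f (Complex x y)" 1 "a * y"]
    by (simp add: Complex_eq add.commute)
  moreover have "Complex x y + of_real (a * Im (Complex x y)) = Complex (x + a * y) y" for x y
    by (simp add: complex_eq_iff)
  ultimately show ?thesis
    by (subst (1 2) nn_integral_complex_iterated(2)) simp_all
qed

lemma nn_integral_complex_shear_Im: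
  fixes f :: "complex \<Rightarrow> ennreal"
  assumes [measurable]: "f \<in> borel_measurable borel"
  shows "(\<integral>\<^sup>+z. f (z + \<i> * of_real (b * Re z)) \<partial>lborel) = (\<integral>\<^sup>+z. f z \<partial>lborel)"
proof -
  have "(\<integral>\<^sup>+y. f (Complex x y) \<partial>lborel) = (\<integral>\<^sup>+y. f (Complex x (y + b * x)) \<partial>lborel)" for x
    using nn_integral_real_affine[of "\<lambda>y. f (Complex x y)" 1 "b * x"]
    by (simp add: Complex_eq add.commute)
  moreover have "Complex x y + \<i> * of_real (b * Re (Complex x y)) = Complex x (y + b * x)" for x y
    by (simp add: complex_eq_iff)
  ultimately show ?thesis
    by (subst (1 2) nn_integral_complex_iterated(1)) simp_all
qed

lemma nn_integral_complex_uminus: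
  fixes f :: "complex \<Rightarrow> ennreal"
  assumes [measurable]: "f \<in> borel_measurable borel"
  shows "(\<integral>\<^sup>+z. f (- z) \<partial>lborel) = (\<integral>\<^sup>+z. f z \<partial>lborel)"
  by (subst (2) lborel_affine[of "-1" 0]) (simp_all add: nn_integral_density nn_integral_distr)

text \<open>Apart from the rotation by \<open>\<pi>\<close>, every rotation is a product of three shears.\<close>

lemma nn_integral_complex_rotate:
  fixes f :: "complex \<Rightarrow> ennreal"
  assumes [measurable]: "f \<in> borel_measurable borel" and "norm u = 1"
  shows "(\<integral>\<^sup>+z. f (u * z) \<partial>lborel) = (\<integral>\<^sup>+z. f z \<partial>lborel)"
proof (cases "u = -1")
  case True
  then show ?thesis using nn_integral_complex_uminus[of f] by simp
next
  case False
  \<comment> \<open>If \<open>u\<close> has angle \<open>\<theta>\<close>, then \<open>t\<close> is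
    the tangent of \<open>\<theta> / 2\<close>, the parameter of the two outer shears; the middle
    shear has parameter \<open>s\<close>, the sine. The denominator vanishes only for
    \<open>u = -1\<close>.\<close>
  define c s t where "c = Re u" and "s = Im u" and "t = s / (1 + c)"
  have cs: "c\<^sup>2 + s\<^sup>2 = 1"
    using assms(2) by (simp add: c_def s_def cmod_def)
  have "c \<noteq> -1"
  proof
    assume "c = -1"
    with cs have "s = 0" by simp
    with \<open>c = -1\<close> False show False by (auto simp: c_def s_def complex_eq_iff)
  qed
  then have c1: "1 + c \<noteq> 0" by (metis add.inverse_inverse add_eq_0_iff)
  have ts: "t * s = 1 - c"
    using c1 cs unfolding t_def by (simp add: field_simps power2_eq_square)
  have t2: "t * (1 + c) = s"
    using c1 by (simp add: t_def)
  define A where "A = (\<lambda>z. z + complex_of_real (- t * Im z))"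
  define B where "B = (\<lambda>z. z + \<i> * complex_of_real (s * Re z))"
  have [measurable]: "A \<in> borel_measurable borel" "B \<in> borel_measurable borel"
    unfolding A_def B_def
    by (auto intro!: borel_measurable_continuous_onI continuous_intros)
  have eq: "u * z = A (B (A z))" for z
  proof -
    have "c * x - s * y = (x - t * y) - t * (y + s * (x - t * y))"
      "c * y + s * x = y + s * (x - t * y)" for x y
      using ts t2 by algebra+
    then show ?thesis
      by (simp add: complex_eq_iff A_def B_def c_def[symmetric] s_def[symmetric])
  qed
  have "(\<integral>\<^sup>+z. f (u * z) \<partial>lborel) = (\<integral>\<^sup>+z. f (A (B (A z))) \<partial>lborel)"
    by (simp add: eq)
  also have "\<dots> = (\<integral>\<^sup>+z. f (A (B z)) \<partial>lborel)"
    using nn_integral_complex_shear_Re[of "\<lambda>z. f (A (B z))" "-t"] by (simp add: A_def)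
  also have "\<dots> = (\<integral>\<^sup>+z. f (A z) \<partial>lborel)"
    using nn_integral_complex_shear_Im[of "\<lambda>z. f (A z)" s] by (simp add: B_def)
  also have "\<dots> = (\<integral>\<^sup>+z. f z \<partial>lborel)"
    using nn_integral_complex_shear_Re[of f "-t"] by (simp add: A_def)
  finally show ?thesis .
qed

text \<open>Cauchy's formula at 0 for \<open>w \<mapsto> h (a + w * z)\<close> on the unit circle.
  The circle of radius \<open>norm z\<close> is parametrized by rotating \<open>z\<close> itself, so
  that the estimate can afterwards be integrated over \<open>z\<close>.\<close>

lemma holomorphic_circle_mean_le:
  assumes h: "h holomorphic_on ball a r" and z: "norm z < r"
  shows "ennreal (norm (h a)) \<le>
    (\<integral>\<^sup>+t. ennreal (norm (h (a + exp (2 * of_real pi * \<i> * of_real t) * z))) * indicator {0..1} t \<partial>lborel)"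
proof -
  define k where "k t = h (a + exp (2 * of_real pi * \<i> * of_real t) * z)" for t :: real
  have in_ball: "a + w * z \<in> ball a r" if "norm w \<le> 1" for w
  proof -
    have "norm w * norm z \<le> 1 * norm z" using that by (intro mult_right_mono) auto
    with z show ?thesis by (simp add: dist_norm norm_mult)
  qed
  have "(\<lambda>w. h (a + w * z)) holomorphic_on cball 0 1"
    by (rule holomorphic_on_compose_gen[of "\<lambda>w. a + w * z" _ h "ball a r", unfolded o_def])
       (auto intro!: holomorphic_intros h simp del: mem_ball simp: in_ball)
  from Cauchy_integral_circlepath_simple[OF this, of 0]
  have "((\<lambda>w. h (a + w * z) / w) has_contour_integral 2 * of_real pi * \<i> * h a) (circlepath 0 1)"
    by simp
  then have "((\<lambda>t. 2 * of_real pi * \<i> * k t) has_integral 2 * of_real pi * \<i> * h a) {0..1}"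
    unfolding has_contour_integral_def
  proof (rule has_integral_eq[rotated])
    fix t :: real
    assume "t \<in> {0..1}"
    then have "vector_derivative (circlepath 0 1) (at t within {0..1})
        = 2 * of_real pi * \<i> * circlepath 0 1 t"
      by (simp add: vector_derivative_circlepath01) (simp add: circlepath)
    moreover have "k t = h (a + circlepath 0 1 t * z)" "circlepath 0 1 t \<noteq> 0"
      by (simp_all add: k_def circlepath)
    ultimately show "h (a + circlepath 0 1 t * z) / circlepath 0 1 t *
        vector_derivative (circlepath 0 1) (at t within {0..1}) = 2 * of_real pi * \<i> * k t"
      by simp
  qed
  from has_integral_mult_right[OF this, of "1 / (2 * of_real pi * \<i>)"]
  have int: "(k has_integral h a) {0..1}" by simp
  have "continuous_on {0..1} k"
    unfolding k_def
    by (rule continuous_on_compose2[OF holomorphic_on_imp_continuous_on[OF h]])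
       (auto intro!: continuous_intros simp del: mem_ball intro!: in_ball)
  then have si: "set_integrable lborel {0..1} k"
    by (intro borel_integrable_atLeastAtMost')
  then have "(LINT t:{0..1}|lborel. k t) = h a"
    using set_borel_integral_eq_integral(2)[OF si] int by (simp add: integral_unique)
  then have "ennreal (norm (h a)) \<le> (\<integral>\<^sup>+t. ennreal (norm (indicator {0..1} t *\<^sub>R k t)) \<partial>lborel)"
    using integral_norm_bound_ennreal[OF si[unfolded set_integrable_def]]
    by (simp add: set_lebesgue_integral_def)
  also have "\<dots> = (\<integral>\<^sup>+t. ennreal (norm (k t)) * indicator {0..1} t \<partial>lborel)"
    by (intro nn_integral_cong) (auto simp: indicator_def)
  finally show ?thesis by (simp add: k_def)
qed

lemma nn_integral_complex_translate:
  fixes f :: "complex \<Rightarrow> ennreal"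
  assumes [measurable]: "f \<in> borel_measurable borel"
  shows "(\<integral>\<^sup>+z. f (a + z) \<partial>lborel) = (\<integral>\<^sup>+z. f z \<partial>lborel)"
  by (subst (2) lborel_distr_plus[of a, symmetric]) (simp add: nn_integral_distr)

text \<open>Outside \<open>S\<close> the values of \<open>h\<close> are arbitrary, so only the
  product with the indicator can be expected to be measurable.\<close>

lemma borel_measurable_norm_holomorphic:
  assumes "h holomorphic_on S" and "open S"
  shows "(\<lambda>z. ennreal (norm (h z)) * indicator S z) \<in> borel_measurable borel"
proof -
  have "(\<lambda>z. if z \<in> S then norm (h z) else 0) \<in> borel_measurable borel"
    by (rule borel_measurable_continuous_on_if)
       (use assms in \<open>auto intro!: continuous_intros holomorphic_on_imp_continuous_on\<close>)
  then have "(\<lambda>z. ennreal (if z \<in> S then norm (h z) else 0)) \<in> borel_measurable borel"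
    by simp
  also have "(\<lambda>z. ennreal (if z \<in> S then norm (h z) else 0)) = (\<lambda>z. ennreal (norm (h z)) * indicator S z)"
    by (auto simp: indicator_def fun_eq_iff)
  finally show ?thesis .
qed

text \<open>Rotation invariance takes the place of polar coordinates: the circle estimate is
  integrated over all \<open>z\<close> in the disk and the order of integration is
  exchanged.\<close>

lemma holomorphic_area_mean_le:
  assumes h: "h holomorphic_on ball a r"
  shows "ennreal (norm (h a)) * emeasure lborel (ball a r) \<le> (\<integral>\<^sup>+z\<in>ball a r. ennreal (norm (h z)) \<partial>lborel)"
proof -
  define g where "g z = ennreal (norm (h z)) * indicator (ball a r) z" for z
  define f where "f z = g (a + z)" for z
  have [measurable]: "g \<in> borel_measurable borel"
    unfolding g_def by (intro borel_measurable_norm_holomorphic h open_ball)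
  then have [measurable]: "f \<in> borel_measurable borel"
    unfolding f_def by measurable
  have ind: "indicator (ball 0 r) (z::complex) = (indicator (ball a r) (a + z) :: ennreal)" for z
    by (auto simp: indicator_def dist_norm)
  have [measurable]: "ball a r \<in> sets borel" by simp
  define e where "e t = exp (2 * of_real pi * \<i> * of_real t)" for t :: real
  have e: "norm (e t) = 1" for t by (simp add: e_def)
  have [measurable]: "(\<lambda>(z, t). e t * z) \<in> borel_measurable (lborel \<Otimes>\<^sub>M lborel)"
    unfolding e_def
    by (subst measurable_cong_sets[where M' = "borel" and N' = borel])
       (auto simp: borel_prod[symmetric] case_prod_unfold
         intro!: borel_measurable_continuous_onI continuous_intros)
  have meas: "(\<lambda>(z, t). f (e t * z) * indicator {0..1} t) \<in> borel_measurable (lborel \<Otimes>\<^sub>M lborel)"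
  proof -
    have "(\<lambda>p. f ((\<lambda>(z, t). e t * z) p) * indicator {0..1} (snd p)) \<in> borel_measurable (lborel \<Otimes>\<^sub>M lborel)"
      by measurable
    then show ?thesis by (simp add: case_prod_unfold)
  qed
  have "ennreal (norm (h a)) * emeasure lborel (ball a r)
      = (\<integral>\<^sup>+z. ennreal (norm (h a)) * indicator (ball a r) z \<partial>lborel)"
    by (simp add: nn_integral_cmult_indicator)
  also have "\<dots> = (\<integral>\<^sup>+z. ennreal (norm (h a)) * indicator (ball a r) (a + z) \<partial>lborel)"
    by (rule nn_integral_complex_translate[symmetric]) measurable
  also have "\<dots> \<le> (\<integral>\<^sup>+z. \<integral>\<^sup>+t. f (e t * z) * indicator {0..1} t \<partial>lborel \<partial>lborel)"
  proof (rule nn_integral_mono)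
    fix z :: complex
    show "ennreal (norm (h a)) * indicator (ball a r) (a + z)
        \<le> (\<integral>\<^sup>+t. f (e t * z) * indicator {0..1} t \<partial>lborel)"
    proof (cases "norm z < r")
      case True
      then have "f (e t * z) = ennreal (norm (h (a + e t * z)))" for t
        using e[of t] by (simp add: f_def g_def indicator_def dist_norm norm_mult)
      with holomorphic_circle_mean_le[OF h True] show ?thesis
        by (auto simp: e_def indicator_def)
    qed (auto simp: indicator_def dist_norm)
  qed
  \<comment> \<open>After the exchange the inner integral is over a rotated copy of
    \<open>f\<close>, hence independent of \<open>t\<close>, and \<open>t\<close> runs through an
    interval of length 1.\<close>
  also have "\<dots> = (\<integral>\<^sup>+t. \<integral>\<^sup>+z. f (e t * z) * indicator {0..1} t \<partial>lborel \<partial>lborel)"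
    by (rule lborel_pair.Fubini'[OF meas, symmetric])
  also have "\<dots> = (\<integral>\<^sup>+t. (\<integral>\<^sup>+z. f z \<partial>lborel) * indicator {0..1::real} t \<partial>lborel)"
    by (simp add: nn_integral_multc nn_integral_complex_rotate e)
  also have "\<dots> = (\<integral>\<^sup>+z. f z \<partial>lborel)"
    by (simp add: nn_integral_cmult_indicator)
  also have "\<dots> = (\<integral>\<^sup>+z. g z \<partial>lborel)"
    unfolding f_def by (rule nn_integral_complex_translate) measurable
  finally show ?thesis by (simp add: g_def)
qed

text \<open>The area mean value inequality for the holomorphic function \<open>h\<^sup>2\<close>.
  The left side is arranged as a square so that roots can be taken later.\<close>

lemma square_mean_le:
  assumes h: "h holomorphic_on ball a r" and r: "r \<ge> 0"
  shows "ennreal (pi * (norm (h a) * r)\<^sup>2) \<le> (\<integral>\<^sup>+z\<in>ball a r. ennreal ((norm (h z))\<^sup>2) \<partial>lborel)"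
proof -
  have "(\<lambda>z. (h z)\<^sup>2) holomorphic_on ball a r"
    by (intro holomorphic_intros h)
  from holomorphic_area_mean_le[OF this]
  have "ennreal ((norm (h a))\<^sup>2) * ennreal (pi * r\<^sup>2)
      \<le> (\<integral>\<^sup>+z\<in>ball a r. ennreal ((norm (h z))\<^sup>2) \<partial>lborel)"
    using r by (simp add: norm_power emeasure_ball unit_ball_vol_2)
  moreover have "ennreal ((norm (h a))\<^sup>2) * ennreal (pi * r\<^sup>2) = ennreal (pi * (norm (h a) * r)\<^sup>2)"
    by (subst ennreal_mult[symmetric]) (auto simp: power_mult_distrib mult_ac)
  ultimately show ?thesis by simp
qed

section \<open>Growth of square integrable holomorphic functions on the unit disk\<close>

lemma ball_subset_unit_ball:
  fixes a :: complex
  assumes "r \<le> 1 - norm a"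
  shows "ball a r \<subseteq> ball 0 1"
proof
  fix z assume "z \<in> ball a r"
  then have "norm (z - a) < r" by (simp add: dist_norm norm_minus_commute)
  with assms norm_triangle_sub[of z a] show "z \<in> ball 0 1" by simp
qed

text \<open>The disk around \<open>a\<close> of radius \<open>1 - norm a\<close> lies in the unit
  disk, so the integral of the squared modulus over it is at most the total integral
  \<open>J\<close>.\<close>

lemma bergman_growth:
  assumes h: "h holomorphic_on ball 0 1"
    and fin: "(\<integral>\<^sup>+z\<in>ball 0 1. ennreal ((norm (h z))\<^sup>2) \<partial>lborel) < \<infinity>"
  shows "\<exists>C. \<forall>a\<in>ball 0 1. norm (h a) * (1 - norm a) \<le> C"
proof -
  obtain J where J: "J \<ge> 0" "(\<integral>\<^sup>+z\<in>ball 0 1. ennreal ((norm (h z))\<^sup>2) \<partial>lborel) = ennreal J"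
    using fin by (cases "\<integral>\<^sup>+z\<in>ball 0 1. ennreal ((norm (h z))\<^sup>2) \<partial>lborel") auto
  have "norm (h a) * (1 - norm a) \<le> sqrt (J / pi)" if a: "a \<in> ball 0 1" for a
  proof -
    have sub: "ball a (1 - norm a) \<subseteq> ball 0 1" by (rule ball_subset_unit_ball) simp
    have "ennreal (pi * (norm (h a) * (1 - norm a))\<^sup>2)
        \<le> (\<integral>\<^sup>+z\<in>ball a (1 - norm a). ennreal ((norm (h z))\<^sup>2) \<partial>lborel)"
      using a by (intro square_mean_le holomorphic_on_subset[OF h sub]) auto
    also have "\<dots> \<le> ennreal J"
      unfolding J(2)[symmetric] using sub
      by (intro nn_integral_mono mult_left_mono) (auto simp: indicator_def)
    finally have "(norm (h a) * (1 - norm a))\<^sup>2 \<le> J / pi"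
      using J(1) by (simp add: field_simps)
    then show ?thesis by (rule real_le_rsqrt)
  qed
  then show ?thesis by blast
qed

text \<open>The disk of radius \<open>t\<close> around \<open>p * (1 - t)\<close> touches the unit
  circle at \<open>p\<close> and shrinks to \<open>p\<close>, so the integral over it tends to 0.
  This improves the bounded quantity of \<open>bergman_growth\<close> to one tending to 0 along the
  radius.\<close>

lemma bergman_radial_limit:
  assumes h: "h holomorphic_on ball 0 1"
    and fin: "(\<integral>\<^sup>+z\<in>ball 0 1. ennreal ((norm (h z))\<^sup>2) \<partial>lborel) < \<infinity>"
    and p: "norm p = 1"
  shows "((\<lambda>t. of_real t * h (p * (1 - of_real t))) \<longlongrightarrow> 0) (at_right (0::real))"
proof -
  define w where "w z = ennreal ((norm (h z))\<^sup>2) * indicator (ball 0 1) z" for z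
  have w: "w \<in> borel_measurable lborel"
    unfolding w_def
    using borel_measurable_norm_holomorphic[OF holomorphic_on_power[OF h, of 2] open_ball]
    by (simp add: norm_power)
  \<comment> \<open>The integral of the squared modulus is viewed as a measure, so that continuity
    from above on the shrinking disks \<open>A n\<close> applies; the limit is the mass of
    \<open>{p}\<close>, which is 0.\<close>
  define \<nu> where "\<nu> = density lborel w"
  define A where "A n = ball p (inverse (real (Suc n)))" for n
  have \<nu>: "emeasure \<nu> X = (\<integral>\<^sup>+z. w z * indicator X z \<partial>lborel)" if "X \<in> sets borel" for X
    unfolding \<nu>_def using that by (subst emeasure_density[OF w]) auto
  have "(\<lambda>n. emeasure \<nu> (A n)) \<longlonglongrightarrow> emeasure \<nu> (\<Inter>n. A n)"
  proof (rule Lim_emeasure_decseq)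
    show "range A \<subseteq> sets \<nu>" by (auto simp: A_def \<nu>_def)
    show "decseq A"
      unfolding decseq_def A_def by (auto intro!: subset_ball simp: field_simps)
    fix n
    have "emeasure \<nu> (A n) \<le> (\<integral>\<^sup>+z. w z \<partial>lborel)"
      by (subst \<nu>) (auto simp: A_def indicator_def intro!: nn_integral_mono)
    then show "emeasure \<nu> (A n) \<noteq> \<infinity>"
      using fin by (auto simp: w_def top_unique)
  qed
  also have "(\<Inter>n. A n) = {p}"
  proof -
    have "z = p" if z: "\<And>n. dist p z < inverse (real (Suc n))" for z
    proof (rule ccontr)
      assume "z \<noteq> p"
      then obtain n where "inverse (real (Suc n)) < dist p z"
        using reals_Archimedean[of "dist p z"] by auto
      with z[of n] show False by simp
    qed
    then show ?thesis by (auto simp: A_def)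
  qed
  also have "emeasure \<nu> {p} = 0"
  proof -
    have "AE z in lborel. w z * indicator {p} z = 0"
      by (rule AE_I[of _ _ "{p}"]) (auto simp: indicator_def)
    then show ?thesis
      using nn_integral_cong_AE[of "\<lambda>z. w z * indicator {p} z" "\<lambda>_. 0" lborel] by (simp add: \<nu>)
  qed
  finally have lim: "(\<lambda>n. emeasure \<nu> (A n)) \<longlonglongrightarrow> 0" .
  show ?thesis
  proof (rule tendstoI)
    fix e :: real assume e: "e > 0"
    then have "0 < ennreal (pi * e\<^sup>2)" by (simp add: ennreal_zero_less_mult_iff)
    from order_tendstoD(2)[OF lim this]
    obtain n where n: "emeasure \<nu> (A n) < ennreal (pi * e\<^sup>2)"
      by (auto simp: eventually_sequentially)
    \<comment> \<open>The bound 1 keeps \<open>p * (1 - t)\<close> at distance \<open>1 - t\<close>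
      from 0; the factor 1/2 is there because the small disk reaches up to distance
      \<open>2 * t\<close> from \<open>p\<close>.\<close>
    define d where "d = min 1 (inverse (real (Suc n)) / 2)"
    have "d > 0" by (simp add: d_def)
    from eventually_at_right_real[OF this]
    show "\<forall>\<^sub>F t in at_right 0. dist (of_real t * h (p * (1 - of_real t))) 0 < e"
    proof eventually_elim
      fix t assume t: "t \<in> {0<..<d}"
      define a where "a = p * (1 - of_real t)"
      have na: "norm a = 1 - t"
        using t p norm_of_real[of "1 - t", where ?'a = complex] by (simp add: a_def norm_mult d_def)
      have sub: "ball a t \<subseteq> ball 0 1" by (rule ball_subset_unit_ball) (simp add: na)
      have subA: "ball a t \<subseteq> A n"
      proof
        fix z assume "z \<in> ball a t"
        moreover have "dist p a = t"
          using t p by (simp add: a_def dist_norm algebra_simps norm_mult)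
        ultimately have "dist p z < 2 * t"
          using dist_triangle[of p z a] by simp
        then show "z \<in> A n" using t by (simp add: A_def d_def)
      qed
      have "ennreal (pi * (norm (h a) * t)\<^sup>2) \<le> (\<integral>\<^sup>+z\<in>ball a t. ennreal ((norm (h z))\<^sup>2) \<partial>lborel)"
        using t by (intro square_mean_le holomorphic_on_subset[OF h sub]) auto
      also have "\<dots> \<le> emeasure \<nu> (A n)"
        using sub subA
        by (subst \<nu>) (auto simp: A_def w_def subset_eq split: split_indicator intro!: nn_integral_mono)
      also note n
      finally have "(norm (h a) * t)\<^sup>2 < e\<^sup>2"
        using e by (simp add: ennreal_less_iff)
      then have "norm (h a) * t < e"
        by (rule power_less_imp_less_base) (use e in simp)
      then show "dist (of_real t * h (p * (1 - of_real t))) 0 < e"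
        using t by (simp add: a_def norm_mult mult.commute)
    qed
  qed
qed

section \<open>Isolated singularities on the unit circle\<close>

text \<open>Along \<open>\<gamma>\<close> the product \<open>(z - p) * g z\<close> tends both to 0
  and to \<open>k p\<close>, so \<open>k p = 0\<close> and Riemann's removable singularity theorem
  applies to \<open>g\<close>. Each use lowers a bound on the order of a pole by one.\<close>

lemma holomorphic_cancel_linear_factor:
  fixes p :: complex
  assumes S: "open S" "p \<in> S"
    and g: "g holomorphic_on S - {p}"
    and k: "k holomorphic_on S" "\<And>z. z \<in> S - {p} \<Longrightarrow> k z = (z - p) * g z"
    and \<gamma>: "filterlim \<gamma> (at p) F" "F \<noteq> bot" "((\<lambda>t. (\<gamma> t - p) * g (\<gamma> t)) \<longlongrightarrow> 0) F"
  shows "\<exists>k'. k' holomorphic_on S \<and> (\<forall>z \<in> S - {p}. k' z = g z)"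
proof -
  have "isCont k p"
    using k(1) S by (metis holomorphic_on_imp_continuous_on continuous_on_eq_continuous_at)
  then have lim: "(k \<longlongrightarrow> k p) (at p)" by (simp add: isCont_def)
  have ev: "\<forall>\<^sub>F z in at p. k z = (z - p) * g z"
    using eventually_at_in_open[OF S] by eventually_elim (use k(2) in auto)
  have "((\<lambda>t. k (\<gamma> t)) \<longlongrightarrow> k p) F"
    by (rule filterlim_compose[OF lim \<gamma>(1)])
  moreover have "\<forall>\<^sub>F t in F. k (\<gamma> t) = (\<gamma> t - p) * g (\<gamma> t)"
    using eventually_compose_filterlim[OF ev \<gamma>(1)] .
  ultimately have "((\<lambda>t. (\<gamma> t - p) * g (\<gamma> t)) \<longlongrightarrow> k p) F"
    by (rule Lim_transform_eventually)
  with \<gamma> have "k p = 0" using tendsto_unique by blast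
  with Lim_transform_eventually[OF lim ev] have "((\<lambda>z. (z - p) * g z) \<longlongrightarrow> 0) (at p)"
    by simp
  with holomorphic_on_extend_lim[OF g] S show ?thesis
    by (simp add: interior_open)
qed

text \<open>Since \<open>p * cnj p = 1\<close>, the expression factors as \<open>w\<close> times
  \<open>(norm (p + w))\<^sup>2 - 1\<close>. On a circle of fixed \<open>norm w\<close> it coincides
  with a polynomial in \<open>w\<close>, so the nonholomorphic weight in a growth bound can be
  replaced by a holomorphic one.\<close>

lemma unit_circle_quadratic:
  fixes p w :: complex
  assumes "norm p = 1"
  shows "norm (cnj p * w\<^sup>2 + (norm w)\<^sup>2 * w + (norm w)\<^sup>2 * p) = norm w * \<bar>(norm (p + w))\<^sup>2 - 1\<bar>"
proof -
  have p: "p * cnj p = 1"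
    using assms by (simp add: complex_norm_square[symmetric])
  have "cnj p * w\<^sup>2 + (norm w)\<^sup>2 * w + (norm w)\<^sup>2 * p = w * ((p + w) * cnj (p + w) - 1)"
    unfolding complex_norm_square[of w] complex_cnj_add using p by algebra
  also have "\<dots> = w * of_real ((norm (p + w))\<^sup>2 - 1)"
    by (simp del: complex_cnj_add add: complex_norm_square[symmetric])
  finally show ?thesis by (simp only: norm_mult norm_of_real)
qed

text \<open>
  The circle of radius \<open>r\<close> around \<open>p\<close> meets the unit circle exactly in the two zeros of the
  quadratic polynomial of the preceding identity, so the product of that polynomial with \<open>f\<close> is
  bounded on the small circle. The maximum principle carries the bound to a fixed point, and
  the polynomial tends to \<open>cnj p * w\<^sup>2\<close> as \<open>r\<close> tends to 0.
\<close>

lemma double_pole_bound: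
  fixes p :: complex
  assumes p: "norm p = 1" and R: "R > 0"
    and f: "f holomorphic_on ball p R - {p}"
    and bnd: "\<And>z. z \<in> ball p R \<Longrightarrow> norm z \<noteq> 1 \<Longrightarrow> norm (f z) * \<bar>(norm z)\<^sup>2 - 1\<bar> \<le> C"
  shows "\<exists>B. \<forall>\<^sub>F z in at p. norm ((z - p)\<^sup>2 * f z) \<le> B"
proof -
  define \<rho> where "\<rho> = R / 2"
  have \<rho>: "0 < \<rho>" "\<rho> < R" using R by (auto simp: \<rho>_def)
  define h where "h w = f (p + w)" for w
  have h: "h holomorphic_on ball 0 R - {0}"
    unfolding h_def
    by (rule holomorphic_on_compose_gen[of "\<lambda>w. p + w" _ f "ball p R - {p}", unfolded o_def])
       (auto intro!: holomorphic_intros f simp: dist_norm)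
  have "compact (h ` sphere 0 \<rho>)"
    by (rule compact_continuous_image[OF holomorphic_on_imp_continuous_on[OF holomorphic_on_subset[OF h]]])
       (use \<rho> in auto)
  then obtain M where "\<forall>w\<in>sphere 0 \<rho>. norm (h w) \<le> M"
    by (auto simp: bounded_iff dest!: compact_imp_bounded)
  then have M: "norm (h w) \<le> M" if "norm w = \<rho>" for w
    using that by simp
  \<comment> \<open>The two entries bound the product on the inner and on the outer boundary circle
    of the annulus; in the second, \<open>r \<le> 1\<close> makes the bound independent of
    \<open>r\<close>.\<close>
  define B where "B = max \<bar>C\<bar> ((\<rho>\<^sup>2 + \<rho> + 1) * \<bar>M\<bar>)"
  \<comment> \<open>The quadratic of \<open>unit_circle_quadratic\<close> with \<open>norm w\<close>
    frozen to the constant \<open>r\<close>, hence holomorphic in \<open>w\<close>.\<close>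
  define q where "q r w = cnj p * w\<^sup>2 + (of_real r)\<^sup>2 * w + (of_real r)\<^sup>2 * p" for r :: real and w
  have key: "norm (q r w * h w) \<le> B" if w: "0 < r" "r \<le> norm w" "norm w \<le> \<rho>" "r \<le> 1" for r w
  proof (rule maximum_modulus_frontier[where S = "cball 0 \<rho> - ball 0 r" and f = "\<lambda>w. q r w * h w"])
    have sub: "cball 0 \<rho> - ball 0 r \<subseteq> ball 0 R - {0::complex}"
      using \<rho> \<open>0 < r\<close> by auto
    have hol: "(\<lambda>w. q r w * h w) holomorphic_on cball 0 \<rho> - ball 0 r"
      unfolding q_def by (intro holomorphic_intros holomorphic_on_subset[OF h] sub)
    then show "(\<lambda>w. q r w * h w) holomorphic_on interior (cball 0 \<rho> - ball 0 r)"
      by (rule holomorphic_on_subset) (rule interior_subset)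
    have cl: "closed (cball 0 \<rho> - ball (0::complex) r)"
      by (intro closed_Diff) auto
    then show "continuous_on (closure (cball 0 \<rho> - ball 0 r)) (\<lambda>w. q r w * h w)"
      using holomorphic_on_imp_continuous_on[OF hol] by simp
    show "bounded (cball 0 \<rho> - ball (0::complex) r)" by (simp add: bounded_diff)
    show "w \<in> cball 0 \<rho> - ball 0 r" using w by simp
    fix z assume z: "z \<in> frontier (cball 0 \<rho> - ball (0::complex) r)"
    then have zS: "z \<in> cball 0 \<rho> - ball 0 r" and zi: "z \<notin> interior (cball 0 \<rho> - ball (0::complex) r)"
      using cl by (auto simp: frontier_def)
    have "norm z = r \<or> norm z = \<rho>"
    proof (rule ccontr)
      assume "\<not> ?thesis"
      with zS have "z \<in> ball 0 \<rho> - cball 0 r" by auto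
      moreover have "ball 0 \<rho> - cball (0::complex) r \<subseteq> interior (cball 0 \<rho> - ball 0 r)"
        by (rule interior_maximal) auto
      ultimately show False using zi by blast
    qed
    then show "norm (q r z * h z) \<le> B"
    proof
      assume r: "norm z = r"
      have nq: "norm (q r z) = r * \<bar>(norm (p + z))\<^sup>2 - 1\<bar>"
        using unit_circle_quadratic[OF p, of z] unfolding q_def r by simp
      have "\<bar>(norm (p + z))\<^sup>2 - 1\<bar> * norm (h z) \<le> \<bar>C\<bar>"
      \<comment> \<open>At a point of the unit circle \<open>bnd\<close> gives no information, but
        the weight vanishes there.\<close>
      proof (cases "norm (p + z) = 1")
        case False
        moreover have "p + z \<in> ball p R" using zS \<rho> by (simp add: dist_norm)
        ultimately show ?thesis using bnd[of "p + z"] by (simp add: h_def mult.commute)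
      qed simp
      then have "norm (q r z * h z) \<le> r * \<bar>C\<bar>"
        using \<open>0 < r\<close> by (simp add: norm_mult nq mult.assoc)
      also have "\<dots> \<le> \<bar>C\<bar>"
        using \<open>0 < r\<close> \<open>r \<le> 1\<close> by (simp add: mult_left_le_one_le)
      finally show ?thesis by (simp add: B_def)
    next
      assume z\<rho>: "norm z = \<rho>"
      have r1: "r\<^sup>2 \<le> 1" using w by (simp add: power_le_one)
      have "norm (q r z) \<le> \<rho>\<^sup>2 + r\<^sup>2 * \<rho> + r\<^sup>2"
        unfolding q_def
        by (intro norm_triangle_mono) (simp_all add: norm_mult norm_power p z\<rho>)
      also have "\<dots> \<le> \<rho>\<^sup>2 + 1 * \<rho> + 1"
        by (intro add_mono mult_right_mono r1) (use \<rho> in auto)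
      finally have "norm (q r z * h z) \<le> (\<rho>\<^sup>2 + \<rho> + 1) * \<bar>M\<bar>"
        unfolding norm_mult using M[OF z\<rho>] \<rho> by (intro mult_mono) auto
      then show ?thesis by (simp add: B_def)
    qed
  qed
  have "norm (w\<^sup>2 * h w) \<le> B" if w: "0 < norm w" "norm w \<le> \<rho>" for w
  proof -
    have "((\<lambda>r. norm (q r w * h w)) \<longlongrightarrow> norm (q 0 w * h w)) (at_right 0)"
      unfolding q_def by (intro tendsto_intros)
    moreover have "\<forall>\<^sub>F r in at_right 0. norm (q r w * h w) \<le> B"
      using eventually_at_right_real[of 0 "min 1 (norm w)"] w
      by (auto elim!: eventually_mono intro!: key)
    ultimately have "norm (q 0 w * h w) \<le> B"
      by (rule tendsto_upperbound) simp
    then show ?thesis by (simp add: q_def norm_mult p)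
  qed
  from this[of "z - p" for z] have "norm ((z - p)\<^sup>2 * f z) \<le> B" if "z \<noteq> p" "dist z p \<le> \<rho>" for z
    using that by (simp add: h_def dist_norm)
  then have "\<forall>\<^sub>F z in at p. norm ((z - p)\<^sup>2 * f z) \<le> B"
    unfolding eventually_at using \<rho>(1) by (intro exI[of _ \<rho>]) auto
  then show ?thesis ..
qed

text \<open>By \<open>double_pole_bound\<close> the singularity is at worst a double pole. The
  radial condition then cancels the two factors \<open>z - p\<close> one after the other.\<close>

lemma removable_of_circle_growth:
  fixes p :: complex
  assumes p: "norm p = 1" and R: "R > 0"
    and f: "f holomorphic_on ball p R - {p}"
    and bnd: "\<And>z. z \<in> ball p R \<Longrightarrow> norm z \<noteq> 1 \<Longrightarrow> norm (f z) * \<bar>(norm z)\<^sup>2 - 1\<bar> \<le> C"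
    and rad: "((\<lambda>t. of_real t * f (p * (1 - of_real t))) \<longlongrightarrow> 0) (at_right (0::real))"
  shows "f \<in> O[at p](\<lambda>_. 1)"
proof -
  let ?S = "ball p R"
  let ?\<gamma> = "\<lambda>t::real. p * (1 - of_real t)"
  have S: "open ?S" "p \<in> ?S" using R by auto
  have p0: "p \<noteq> 0" using p by auto
  have \<gamma>: "filterlim ?\<gamma> (at p) (at_right 0)"
    unfolding filterlim_at
  proof
    show "\<forall>\<^sub>F t in at_right 0. ?\<gamma> t \<in> UNIV \<and> ?\<gamma> t \<noteq> p"
      using eventually_at_right_less[of 0] by eventually_elim (use p0 in auto)
    show "(?\<gamma> \<longlongrightarrow> p) (at_right 0)"
      by (rule tendsto_eq_intros refl | simp)+
  qed
  \<comment> \<open>On the radial path \<open>?\<gamma> t - p\<close> equals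
    \<open>- p * t\<close>.\<close>
  have rad1: "((\<lambda>t. (?\<gamma> t - p) * f (?\<gamma> t)) \<longlongrightarrow> 0) (at_right 0)"
    using tendsto_mult[OF tendsto_const[of "- p"] rad] by (simp add: algebra_simps)
  have rad2: "((\<lambda>t. (?\<gamma> t - p) * ((?\<gamma> t - p) * f (?\<gamma> t))) \<longlongrightarrow> 0) (at_right 0)"
  proof -
    have "((\<lambda>t. ?\<gamma> t - p) \<longlongrightarrow> 0) (at_right 0)"
      by (rule tendsto_eq_intros refl | simp)+
    from tendsto_mult[OF this rad1] show ?thesis by simp
  qed
  have "(\<lambda>z. (z - p)\<^sup>2 * f z) holomorphic_on ?S - {p}"
    by (intro holomorphic_intros f)
  from holomorphic_on_extend_bounded[OF this] S double_pole_bound[OF p R f bnd]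
  obtain k where k: "k holomorphic_on ?S" "\<And>z. z \<in> ?S - {p} \<Longrightarrow> k z = (z - p) * ((z - p) * f z)"
    by (auto simp: power2_eq_square mult.assoc)
  have "(\<lambda>z. (z - p) * f z) holomorphic_on ?S - {p}"
    by (intro holomorphic_intros f)
  from holomorphic_cancel_linear_factor[OF S this k \<gamma> _ rad2]
  obtain k1 where k1: "k1 holomorphic_on ?S" "\<And>z. z \<in> ?S - {p} \<Longrightarrow> k1 z = (z - p) * f z"
    by auto
  from holomorphic_cancel_linear_factor[OF S f k1 \<gamma> _ rad1]
  have "\<exists>k'. k' holomorphic_on ?S \<and> (\<forall>z\<in>?S - {p}. k' z = f z)" by simp
  with holomorphic_on_extend_bounded[OF f] S
  obtain B where "\<forall>\<^sub>F z in at p. norm (f z) \<le> B" by auto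
  then show ?thesis by (intro bigoI[where c = B]) simp
qed

section \<open>Continuation across the unit circle\<close>

text \<open>The identity theorem, with the midpoint of the real interval as the required limit
  point.\<close>

lemma holomorphic_eq_of_eq_on_reals:
  assumes f: "f holomorphic_on S" and g: "g holomorphic_on S"
    and S: "open S" "connected S"
    and ab: "a < (b::real)"
    and eq: "\<And>x. a < x \<Longrightarrow> x < b \<Longrightarrow> of_real x \<in> S \<and> f (of_real x) = g (of_real x)"
    and w: "w \<in> S"
  shows "f w = g w"
proof -
  let ?U = "complex_of_real ` {a<..<b}" and ?\<xi> = "complex_of_real ((a + b) / 2)"
  have "?\<xi> islimpt ?U"
    unfolding islimpt_approachable
  proof (intro allI impI)
    fix e :: real assume e: "e > 0"
    define x where "x = (a + b) / 2 + min (e / 2) ((b - a) / 4)"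
    have m: "0 < min (e / 2) ((b - a) / 4)" "min (e / 2) ((b - a) / 4) < e"
      "min (e / 2) ((b - a) / 4) \<le> (b - a) / 4"
      using e ab by (auto simp: min_def)
    have "x \<in> {a<..<b}" "x \<noteq> (a + b) / 2" "\<bar>x - (a + b) / 2\<bar> < e"
      using m ab by (auto simp: x_def field_simps simp del: min_less_iff_conj min_less_iff_disj)
    then show "\<exists>y\<in>?U. y \<noteq> ?\<xi> \<and> dist y ?\<xi> < e"
      by (intro bexI[of _ "of_real x"])
         (auto simp: dist_norm of_real_diff[symmetric] simp del: of_real_diff of_real_add of_real_divide)
  qed
  moreover have "?U \<subseteq> S" by (rule image_subsetI) (simp add: eq)
  moreover have "?\<xi> \<in> S" using eq[of "(a + b) / 2"] ab by auto
  moreover have "f z - g z = 0" if "z \<in> ?U" for z using that by (auto simp: eq)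
  ultimately have "f w - g w = 0"
    using analytic_continuation[OF holomorphic_on_diff[OF f g] S, of ?U ?\<xi> w] w by blast
  then show ?thesis by simp
qed

section \<open>The branch of the square root of \<open>1 + z\<^sup>2\<close>\<close>

lemma one_plus_square_notin_nonpos_Reals:
  assumes "norm z < 1 \<or> Re z \<noteq> 0"
  shows "1 + z\<^sup>2 \<notin> \<real>\<^sub>\<le>\<^sub>0"
proof
  assume "1 + z\<^sup>2 \<in> \<real>\<^sub>\<le>\<^sub>0"
  then have *: "Im (z\<^sup>2) = 0" "1 + Re (z\<^sup>2) \<le> 0"
    by (auto simp: complex_nonpos_Reals_iff)
  then have ri: "Re z = 0 \<or> Im z = 0" "1 + (Re z)\<^sup>2 \<le> (Im z)\<^sup>2"
    by (auto simp: Re_power2 Im_power2)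
  have "Im z \<noteq> 0"
  proof
    assume "Im z = 0"
    with ri(2) have "1 + (Re z)\<^sup>2 \<le> 0" by simp
    then show False using zero_le_power2[of "Re z"] by linarith
  qed
  with ri have "Re z = 0" "(Im z)\<^sup>2 \<ge> 1" by auto
  with assms cmod_power2[of z] power_strict_mono[of "norm z" 1 2] show False by auto
qed

text \<open>The value \<open>1 + z\<^sup>2\<close> meets the cut of \<open>csqrt\<close> only if
  \<open>z\<close> is imaginary of modulus at least 1. What remains contains the unit disk and both
  open half planes.\<close>

lemma holomorphic_csqrt_one_plus_square:
  "(\<lambda>z. csqrt (1 + z\<^sup>2)) holomorphic_on {z. norm z < 1 \<or> Re z \<noteq> 0}"
  by (intro holomorphic_intros) (simp add: one_plus_square_notin_nonpos_Reals)

text \<open>Both sides have the same square; the sign is settled on the positive reals and carried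
  over the half plane by the identity theorem. Replacing \<open>z\<close> by \<open>- z\<close>
  gives the opposite sign in the left half plane.\<close>

lemma csqrt_one_plus_square_inverse:
  assumes "Re z > 0"
  shows "csqrt (1 + z\<^sup>2) = z * csqrt (1 + (1 / z)\<^sup>2)"
proof (rule holomorphic_eq_of_eq_on_reals[where f = "\<lambda>z. csqrt (1 + z\<^sup>2)"
      and g = "\<lambda>z. z * csqrt (1 + (1 / z)\<^sup>2)" and S = "{z. Re z > 0}" and a = 0 and b = 1])
  have Re_inv: "Re (1 / z) > 0" if "Re z > 0" for z
    using that by (cases "z = 0") (auto simp: Re_divide power2_eq_square[symmetric] intro!: divide_pos_pos sum_power2_gt_zero_iff[THEN iffD2])
  show "(\<lambda>z. csqrt (1 + z\<^sup>2)) holomorphic_on {z. Re z > 0}"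
    by (rule holomorphic_on_subset[OF holomorphic_csqrt_one_plus_square]) auto
  have "(\<lambda>z. csqrt (1 + (1 / z)\<^sup>2)) holomorphic_on {z. Re z > 0}"
    by (rule holomorphic_on_compose_gen[OF _ holomorphic_csqrt_one_plus_square, unfolded o_def])
       (use Re_inv in \<open>fastforce intro!: holomorphic_intros\<close>)+
  then show "(\<lambda>z. z * csqrt (1 + (1 / z)\<^sup>2)) holomorphic_on {z. Re z > 0}"
    by (rule holomorphic_on_mult[OF holomorphic_on_ident])
  show "connected {z. Re z > 0}"
    by (intro convex_connected convex_halfspace_Re_gt)
  fix x :: real assume x: "0 < x" "x < 1"
  have "sqrt (1 + x\<^sup>2) = x * sqrt (1 + (1 / x)\<^sup>2)"
    using x by (intro real_sqrt_unique) (auto simp: power_mult_distrib field_simps)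
  moreover have "csqrt (1 + (complex_of_real y)\<^sup>2) = of_real (sqrt (1 + y\<^sup>2))" for y
    using csqrt_of_real_nonneg[of "of_real (1 + y\<^sup>2)"] by simp
  ultimately show "complex_of_real x \<in> {z. Re z > 0} \<and>
      csqrt (1 + (complex_of_real x)\<^sup>2) = of_real x * csqrt (1 + (1 / complex_of_real x)\<^sup>2)"
    using x by (metis Re_complex_of_real mem_Collect_eq of_real_1 of_real_divide of_real_mult)
qed (use assms in \<open>auto simp: open_halfspace_Re_gt\<close>)

text \<open>
  The identity theorem is applied in logarithmic coordinates, where a neighbourhood of a closed
  subarc contains a rectangle and its part outside the unit disk is again a rectangle, hence
  connected.
\<close>

lemma eq_near_right_unit_arc:
  assumes U: "open U" "{z. norm z = 1 \<and> Re z > 0} \<subseteq> U"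
    and H: "H holomorphic_on U" and K: "K holomorphic_on - cball 0 1"
    and eq: "\<And>t. t > 1 \<Longrightarrow> of_real t \<in> U \<Longrightarrow> H (of_real t) = K (of_real t)"
    and \<zeta>: "norm \<zeta> = 1" "Re \<zeta> > 0"
  shows "\<forall>\<^sub>F z in nhds \<zeta>. z \<in> U \<and> (norm z > 1 \<longrightarrow> H z = K z)"
proof -
  define \<alpha> where "\<alpha> = \<bar>Im (Ln \<zeta>)\<bar>"
  have \<zeta>0: "\<zeta> \<noteq> 0" using \<zeta> by auto
  have \<alpha>: "0 \<le> \<alpha>" "\<alpha> < pi / 2"
    using Re_Ln_pos_lt[OF \<zeta>0] \<zeta> by (auto simp: \<alpha>_def)
  \<comment> \<open>\<open>exp\<close> maps \<open>T\<close> onto the closed arc between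
    \<open>\<zeta>\<close> and \<open>cnj \<zeta>\<close> through 1. The arc reaches the positive
    real axis, where \<open>eq\<close> is given.\<close>
  define T where "T = cbox (Complex 0 (- \<alpha>)) (Complex 0 \<alpha>)"
  have T: "w \<in> T \<longleftrightarrow> Re w = 0 \<and> \<bar>Im w\<bar> \<le> \<alpha>" for w
    by (auto simp: T_def cbox_complex_eq)
  have "T \<subseteq> exp -` U"
  proof
    fix w assume w: "w \<in> T"
    then have "cos (Im w) > 0"
      using \<alpha> by (intro cos_gt_zero_pi) (auto simp: T)
    with w U(2) show "w \<in> exp -` U" by (auto simp: T Re_exp)
  qed
  moreover have "open (exp -` U)"
    by (intro open_vimage U continuous_intros)
  moreover have "compact T" by (simp add: T_def)
  ultimately obtain \<epsilon> where \<epsilon>: "\<epsilon> > 0" "(\<Union>w\<in>T. ball w \<epsilon>) \<subseteq> exp -` U"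
    using compact_subset_open_imp_ball_epsilon_subset by metis
  \<comment> \<open>A rectangle in the right half plane, so \<open>exp\<close> maps it outside the
    closed unit disk. The margins \<open>\<epsilon> / 2\<close> in both coordinates keep every point
    within distance \<open>\<epsilon>\<close> of \<open>T\<close>.\<close>
  define Q where "Q = box (Complex 0 (- \<alpha> - \<epsilon> / 2)) (Complex (\<epsilon> / 2) (\<alpha> + \<epsilon> / 2))"
  have Q: "w \<in> Q \<longleftrightarrow> 0 < Re w \<and> Re w < \<epsilon> / 2 \<and> \<bar>Im w\<bar> < \<alpha> + \<epsilon> / 2" for w
    by (auto simp: Q_def box_complex_eq)
  have QU: "exp w \<in> U \<inter> - cball 0 1" if w: "w \<in> Q" for w
  proof -
    \<comment> \<open>The point of \<open>T\<close> nearest to \<open>w\<close>.\<close>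
    define v where "v = Complex 0 (max (- \<alpha>) (min \<alpha> (Im w)))"
    have "v \<in> T" using \<alpha> by (auto simp: T v_def)
    moreover have "\<bar>Re (v - w)\<bar> < \<epsilon> / 2" "\<bar>Im (v - w)\<bar> < \<epsilon> / 2"
      using w \<alpha> \<epsilon>(1) by (auto simp: Q v_def max_def min_def)
    then have "dist v w < \<epsilon>"
      unfolding dist_norm using cmod_le[of "v - w"] by linarith
    ultimately have "w \<in> (\<Union>w\<in>T. ball w \<epsilon>)" by auto
    then have "exp w \<in> U" using \<epsilon>(2) by blast
    then show ?thesis using w by (simp add: Q)
  qed
  have HK: "H (exp w) = K (exp w)" if w: "w \<in> Q" for w
  proof (rule holomorphic_eq_of_eq_on_reals[where f = "\<lambda>w. H (exp w)" and g = "\<lambda>w. K (exp w)"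
        and S = Q and a = 0 and b = "\<epsilon> / 2"])
    show "(\<lambda>w. H (exp w)) holomorphic_on Q"
      by (rule holomorphic_on_compose_gen[OF _ H, unfolded o_def]) (use QU in \<open>auto intro!: holomorphic_intros\<close>)
    show "(\<lambda>w. K (exp w)) holomorphic_on Q"
      by (rule holomorphic_on_compose_gen[OF _ K, unfolded o_def])
         (use QU in \<open>auto intro!: holomorphic_intros simp del: norm_exp_eq_Re\<close>)
    show "open Q" "connected Q" by (auto simp: Q_def open_box intro!: convex_connected convex_box)
    fix x :: real assume x: "0 < x" "x < \<epsilon> / 2"
    then have xQ: "of_real x \<in> Q" using \<alpha> \<epsilon> by (simp add: Q)
    have "exp (complex_of_real x) = of_real (exp x)" by (simp add: exp_of_real)
    with QU[OF xQ] eq[of "exp x"] x xQ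
    show "of_real x \<in> Q \<and> H (exp (of_real x)) = K (exp (of_real x))" by simp
  qed (use w \<epsilon> in auto)
  have "Ln \<midarrow>\<zeta>\<rightarrow> Ln \<zeta>"
    using continuous_at_Ln[of \<zeta>] \<zeta> by (simp add: isCont_def complex_nonpos_Reals_iff)
  then have LnL: "(Ln \<longlongrightarrow> Ln \<zeta>) (nhds \<zeta>)" by (simp add: tendsto_nhds_iff)
  have "\<forall>\<^sub>F z in nhds \<zeta>. Re (Ln z) < \<epsilon> / 2"
    by (rule order_tendstoD(2)[OF tendsto_Re[OF LnL]]) (use \<zeta> \<zeta>0 \<epsilon> in auto)
  moreover have "\<forall>\<^sub>F z in nhds \<zeta>. \<bar>Im (Ln z)\<bar> < \<alpha> + \<epsilon> / 2"
    by (rule order_tendstoD(2)[OF tendsto_rabs[OF tendsto_Im[OF LnL]]])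
       (use \<epsilon> in \<open>auto simp: \<alpha>_def\<close>)
  moreover have "\<forall>\<^sub>F z in nhds \<zeta>. z \<in> U"
    using U \<zeta> by (intro eventually_nhds_in_open) auto
  ultimately show ?thesis
  proof eventually_elim
    case (elim z)
    have "H z = K z" if z: "norm z > 1"
    proof -
      have z0: "z \<noteq> 0" using z by auto
      then have "Ln z \<in> Q" using elim z by (simp add: Q)
      from HK[OF this] z0 show ?thesis by simp
    qed
    with elim show ?case by simp
  qed
qed

section \<open>The single-valued extension and its constancy\<close>

lemma tendsto_csqrt_factor:
  assumes "G holomorphic_on ball 0 1"
  shows "((\<lambda>w. cnj (G (cnj w)) * csqrt (1 + w\<^sup>2)) \<longlongrightarrow> cnj (G 0)) (nhds 0)"
proof -
  have "isCont G 0"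
    using holomorphic_on_imp_continuous_on[OF assms] by (simp add: continuous_on_eq_continuous_at)
  then have G: "(G \<longlongrightarrow> G 0) (nhds 0)" by (simp add: isCont_def tendsto_nhds_iff)
  have "(cnj \<longlongrightarrow> cnj 0) (nhds 0)" by (intro tendsto_intros filterlim_ident)
  then have 1: "((\<lambda>w. cnj (G (cnj w))) \<longlongrightarrow> cnj (G 0)) (nhds 0)"
    by (intro tendsto_cnj filterlim_compose[OF G]) simp
  have "isCont (\<lambda>w. csqrt (1 + w\<^sup>2)) 0"
    using holomorphic_on_imp_continuous_on[OF holomorphic_on_subset[OF holomorphic_csqrt_one_plus_square, of "ball 0 1"]]
    by (auto simp: continuous_on_eq_continuous_at)
  then have "((\<lambda>w. csqrt (1 + w\<^sup>2)) \<longlongrightarrow> csqrt (1 + 0\<^sup>2)) (nhds 0)"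
    by (simp add: isCont_def tendsto_nhds_iff)
  from tendsto_mult[OF 1 this] show ?thesis by simp
qed

text \<open>The dilation products enter only through the functional equations \<open>Hr\<close> and
  \<open>Hl\<close> on the reals outside the closed disk. The values at \<open>1\<close> and
  \<open>-1\<close>, which lie outside the open disk, are delivered through
  \<open>H\<close>.\<close>

lemma constant_of_extension:
  fixes G1 G2 H :: "complex \<Rightarrow> complex"
  assumes G1: "G1 holomorphic_on ball 0 1" and G2: "G2 holomorphic_on ball 0 1"
    and I1: "(\<integral>\<^sup>+z\<in>ball 0 1. ennreal ((norm (G1 z * csqrt (1 + z\<^sup>2)))\<^sup>2) \<partial>lborel) < \<infinity>"
    and I2: "(\<integral>\<^sup>+z\<in>ball 0 1. ennreal ((norm (G2 z * csqrt (1 + z\<^sup>2)))\<^sup>2) \<partial>lborel) < \<infinity>"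
    and U: "open U" "cball 0 1 - {\<i>, -\<i>} \<subseteq> U" and H: "H holomorphic_on U"
    and HG: "\<And>z. z \<in> ball 0 1 \<Longrightarrow> H z = G1 z"
    and Hr: "\<And>t. t > 1 \<Longrightarrow> of_real t \<in> U \<Longrightarrow> H (of_real t) = cnj (G2 (1 / of_real t)) / of_real t"
    and Hl: "\<And>t. t > 1 \<Longrightarrow> - of_real t \<in> U \<Longrightarrow> H (- of_real t) = cnj (G2 (- (1 / of_real t))) / of_real t"
  shows "\<exists>c. (\<forall>z\<in>ball 0 1. G1 z * csqrt (1 + z\<^sup>2) = c \<and> G2 z * csqrt (1 + z\<^sup>2) = cnj c)
    \<and> H 1 * csqrt 2 = c \<and> H (-1) * csqrt 2 = c"
proof -
  define s where "s z = csqrt (1 + z\<^sup>2)" for z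
  define W where "W = {z. norm z < 1 \<or> Re z \<noteq> 0}"
  have W: "open W"
    unfolding W_def by (intro open_Collect_disj open_Collect_less open_Collect_neq continuous_intros)
  have s: "s holomorphic_on W"
    unfolding s_def W_def by (rule holomorphic_csqrt_one_plus_square)
  have ball_W: "ball 0 1 \<subseteq> W" by (auto simp: W_def)
  have s_inv_pos: "s z = z * s (1 / z)" if "Re z > 0" for z
    using csqrt_one_plus_square_inverse[OF that] by (simp add: s_def)
  have s_inv_neg: "s z = - z * s (1 / z)" if "Re z < 0" for z
    using csqrt_one_plus_square_inverse[of "- z"] that by (simp add: s_def)
  define \<Psi> where "\<Psi> w = cnj (G2 (cnj w)) * s w" for w
  \<comment> \<open>The candidate for the continuation of \<open>G1\<close> outside the disk:
    \<open>Hr\<close> says that \<open>H\<close> equals \<open>K\<close> on the right ray,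
    \<open>Hl\<close> that it equals \<open>- K\<close> on the left ray.\<close>
  define K where "K z = cnj (G2 (cnj (1 / z))) / z" for z
  \<comment> \<open>Outside the disk the root is taken at \<open>1 / z\<close>, inside the disk, so
    the cuts of \<open>s\<close> along the imaginary axis do not appear in
    \<open>\<Phi>\<close>.\<close>
  define \<Phi> where "\<Phi> z = (if norm z < 1 then G1 z * s z else if norm z > 1 then \<Psi> (1 / z) else H z * s z)" for z
  have "cnj \<circ> G2 \<circ> cnj holomorphic_on ball 0 1"
    by (rule holomorphic_on_compose_cnj_cnj) (auto intro: holomorphic_on_subset[OF G2])
  then have cG2: "(\<lambda>w. cnj (G2 (cnj w))) holomorphic_on ball 0 1" by (simp add: o_def)
  have inv_ball: "1 / z \<in> ball 0 1" if "z \<in> - cball 0 1" for z :: complex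
    using that by (auto simp: norm_divide divide_less_eq_1 not_le)
  have \<Psi>: "\<Psi> holomorphic_on ball 0 1"
    unfolding \<Psi>_def by (intro holomorphic_intros cG2 holomorphic_on_subset[OF s] ball_W)
  have inv_hol: "(\<lambda>z::complex. 1 / z) holomorphic_on - cball 0 1"
    by (intro holomorphic_intros) auto
  have inv_img: "(\<lambda>z::complex. 1 / z) ` (- cball 0 1) \<subseteq> ball 0 1" using inv_ball by auto
  have \<Psi>i: "(\<lambda>z. \<Psi> (1 / z)) holomorphic_on - cball 0 1"
    by (rule holomorphic_on_compose_gen[OF inv_hol \<Psi> inv_img, unfolded o_def])
  have "(\<lambda>z. cnj (G2 (cnj (1 / z)))) holomorphic_on - cball 0 1"
    by (rule holomorphic_on_compose_gen[OF inv_hol cG2 inv_img, unfolded o_def])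
  then have K: "K holomorphic_on - cball 0 1"
    unfolding K_def by (intro holomorphic_intros) auto

  have circle_U: "z \<in> U" if "norm z = 1" "Re z \<noteq> 0" for z
  proof -
    have "z \<noteq> \<i>" "z \<noteq> - \<i>" using that by auto
    with that U(2) show ?thesis by auto
  qed
  \<comment> \<open>Near each point of the circle other than \<open>\<plusminus>\<i>\<close>, the
    three pieces of \<open>\<Phi>\<close> are one function \<open>H z * s z\<close>.\<close>
  have circle: "\<forall>\<^sub>F z in nhds \<zeta>. \<Phi> z = H z * s z \<and> z \<in> U \<inter> W" if \<zeta>: "norm \<zeta> = 1" "Re \<zeta> \<noteq> 0" for \<zeta>
  proof -
    have ev: "\<forall>\<^sub>F z in nhds \<zeta>. z \<in> U \<inter> W \<and> (norm z > 1 \<longrightarrow> \<Psi> (1 / z) = H z * s z)"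
    proof (cases "Re \<zeta> > 0")
      case True
      have "\<forall>\<^sub>F z in nhds \<zeta>. z \<in> U \<and> (norm z > 1 \<longrightarrow> H z = K z)"
        by (rule eq_near_right_unit_arc[OF U(1) _ H K _ \<zeta>(1) True])
           (auto simp: circle_U Hr K_def)
      moreover have "\<forall>\<^sub>F z in nhds \<zeta>. z \<in> {z. Re z > 0}"
        using True by (intro eventually_nhds_in_open open_halfspace_Re_gt) auto
      ultimately show ?thesis
      proof eventually_elim
        case (elim z)
        then have "z \<noteq> 0" "s z = z * s (1 / z)" using s_inv_pos[of z] by auto
        with elim show ?case by (simp add: W_def K_def \<Psi>_def)
      qed
    next
      case False
      \<comment> \<open>The left arc is moved to the right one by \<open>z \<mapsto> - z\<close>.
        The continuation there is \<open>- K\<close>, and its sign cancels against the sign in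
        \<open>s_inv_neg\<close>.\<close>
      with \<zeta> have neg: "Re (- \<zeta>) > 0" by simp
      define V where "V = uminus -` U"
      have V: "open V" unfolding V_def by (intro open_vimage U continuous_intros)
      have "\<forall>\<^sub>F z in nhds (- \<zeta>). z \<in> V \<and> (norm z > 1 \<longrightarrow> H (- z) = - K (- z))"
      proof (rule eq_near_right_unit_arc[OF V])
        show "{z. norm z = 1 \<and> Re z > 0} \<subseteq> V"
          by (auto simp: V_def circle_U)
        show "(\<lambda>z. H (- z)) holomorphic_on V"
          by (rule holomorphic_on_compose_gen[OF _ H, unfolded o_def]) (auto simp: V_def intro!: holomorphic_intros)
        have "(\<lambda>z. K (- z)) holomorphic_on - cball 0 1"
          by (rule holomorphic_on_compose_gen[OF _ K, unfolded o_def]) (auto intro!: holomorphic_intros)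
        then show "(\<lambda>z. - K (- z)) holomorphic_on - cball 0 1"
          by (intro holomorphic_intros)
        show "H (- of_real t) = - K (- of_real t)" if "t > 1" "of_real t \<in> V" for t
          using that Hl[of t] by (simp add: V_def K_def)
      qed (use \<zeta> neg in auto)
      moreover have "filterlim uminus (nhds (- \<zeta>)) (nhds \<zeta>)"
        by (intro tendsto_intros filterlim_ident)
      ultimately have "\<forall>\<^sub>F z in nhds \<zeta>. - z \<in> V \<and> (norm (- z) > 1 \<longrightarrow> H (- (- z)) = - K (- (- z)))"
        by (rule eventually_compose_filterlim)
      moreover have "\<forall>\<^sub>F z in nhds \<zeta>. z \<in> {z. Re z < 0}"
        using neg by (intro eventually_nhds_in_open open_halfspace_Re_lt) auto
      ultimately show ?thesis
      proof eventually_elim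
        case (elim z)
        then have "z \<noteq> 0" "s z = - z * s (1 / z)" using s_inv_neg[of z] by auto
        with elim show ?case by (simp add: V_def W_def K_def \<Psi>_def)
      qed
    qed
    then show ?thesis
      by eventually_elim (auto simp: \<Phi>_def HG)
  qed

  have \<Phi>: "\<Phi> holomorphic_on UNIV - {\<i>, -\<i>}"
  proof (rule analytic_imp_holomorphic, subst analytic_on_analytic_at, intro ballI)
    fix z assume z: "z \<in> UNIV - {\<i>, -\<i>}"
    have transfer: "\<Phi> analytic_on {z}" if "\<forall>\<^sub>F w in nhds z. \<Phi> w = \<phi> w" "\<phi> analytic_on {z}" for \<phi>
      using analytic_at_cong[OF that(1) refl] that(2) by simp
    consider "norm z < 1" | "norm z > 1" | "norm z = 1" by linarith
    then show "\<Phi> analytic_on {z}"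
    proof cases
      case 1
      have "\<forall>\<^sub>F w in nhds z. w \<in> ball 0 1" using 1 by (intro eventually_nhds_in_open) auto
      then have "\<forall>\<^sub>F w in nhds z. \<Phi> w = G1 w * s w" by eventually_elim (auto simp: \<Phi>_def)
      moreover have "(\<lambda>w. G1 w * s w) holomorphic_on ball 0 1"
        by (intro holomorphic_intros G1 holomorphic_on_subset[OF s] ball_W)
      then have "(\<lambda>w. G1 w * s w) analytic_on {z}"
        using 1 by (intro holomorphic_on_imp_analytic_at[where A = "ball 0 1"]) auto
      ultimately show ?thesis by (rule transfer)
    next
      case 2
      have "\<forall>\<^sub>F w in nhds z. w \<in> - cball 0 1" using 2 by (intro eventually_nhds_in_open) auto
      then have "\<forall>\<^sub>F w in nhds z. \<Phi> w = \<Psi> (1 / w)" by eventually_elim (auto simp: \<Phi>_def)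
      moreover have "(\<lambda>w. \<Psi> (1 / w)) analytic_on {z}"
        using 2 by (intro holomorphic_on_imp_analytic_at[OF \<Psi>i]) auto
      ultimately show ?thesis by (rule transfer)
    next
      case 3
      have "Re z \<noteq> 0"
      proof
        assume "Re z = 0"
        with 3 have "\<bar>Im z\<bar> = 1" by (simp add: cmod_eq_Im)
        with \<open>Re z = 0\<close> z show False by (auto simp: complex_eq_iff)
      qed
      from circle[OF 3 this] have ev: "\<forall>\<^sub>F w in nhds z. \<Phi> w = H w * s w" and zUW: "z \<in> U \<inter> W"
        by (auto elim: eventually_mono dest: eventually_nhds_x_imp_x)
      have "(\<lambda>w. H w * s w) holomorphic_on U \<inter> W"
        by (intro holomorphic_intros holomorphic_on_subset[OF s] holomorphic_on_subset[OF H]) auto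
      then have "(\<lambda>w. H w * s w) analytic_on {z}"
        using zUW U W by (intro holomorphic_on_imp_analytic_at[where A = "U \<inter> W"]) auto
      with ev show ?thesis by (rule transfer)
    qed
  qed

  have hs: "(\<lambda>z. G1 z * s z) holomorphic_on ball 0 1" "(\<lambda>z. G2 z * s z) holomorphic_on ball 0 1"
    by (intro holomorphic_intros G1 G2 holomorphic_on_subset[OF s] ball_W)+
  obtain C1 where "\<forall>z\<in>ball 0 1. norm (G1 z * s z) * (1 - norm z) \<le> C1"
    using bergman_growth[OF hs(1) I1[folded s_def]] by blast
  then have C1: "norm (G1 z * s z) * (1 - norm z) \<le> C1" if "norm z < 1" for z
    using that by simp
  obtain C2 where "\<forall>z\<in>ball 0 1. norm (G2 z * s z) * (1 - norm z) \<le> C2"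
    using bergman_growth[OF hs(2) I2[folded s_def]] by blast
  then have C2: "norm (G2 z * s z) * (1 - norm z) \<le> C2" if "norm z < 1" for z
    using that by simp
  have C1_0: "0 \<le> C1" using order.trans[OF _ C1[of 0]] by simp
  have C2_0: "0 \<le> C2" using order.trans[OF _ C2[of 0]] by simp
  \<comment> \<open>Inside the disk the extra factor \<open>1 + norm z\<close> is at most 2;
    outside, the factor \<open>norm z * (1 + norm z)\<close> is at most 2 * 3.\<close>
  have growth: "norm (\<Phi> z) * \<bar>(norm z)\<^sup>2 - 1\<bar> \<le> 2 * C1 + 6 * C2" if z: "norm z \<noteq> 1" "norm z \<le> 2" for z
  proof (cases "norm z < 1")
    case True
    have "(norm z)\<^sup>2 < 1" using True by (simp add: power_less_one_iff)
    then have "\<bar>(norm z)\<^sup>2 - 1\<bar> = (1 - norm z) * (1 + norm z)"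
      by (simp add: algebra_simps power2_eq_square)
    then have "norm (\<Phi> z) * \<bar>(norm z)\<^sup>2 - 1\<bar> = norm (G1 z * s z) * (1 - norm z) * (1 + norm z)"
      using True by (simp add: \<Phi>_def)
    also have "\<dots> \<le> C1 * 2"
      using C1[OF True] True C1_0 by (intro mult_mono) auto
    finally show ?thesis using C2_0 by simp
  next
    case False
    with z have z1: "norm z > 1" by simp
    \<comment> \<open>The reflection of \<open>z\<close> in the unit circle, which turns the
      exterior estimate into the bound \<open>C2\<close> for \<open>G2 * s\<close>.\<close>
    define v where "v = cnj (1 / z)"
    have v: "norm v = 1 / norm z" "norm v < 1" using z1 by (auto simp: v_def norm_divide divide_less_eq_1)
    have "norm (1 + (1 / z)\<^sup>2) = norm (cnj (1 + (1 / z)\<^sup>2))" by (rule complex_mod_cnj[symmetric])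
    also have "cnj (1 + (1 / z)\<^sup>2) = 1 + v\<^sup>2" by (simp add: v_def)
    finally have "norm (\<Phi> z) = norm (G2 v * s v)"
      using z1 by (simp add: \<Phi>_def \<Psi>_def norm_mult s_def v_def)
    moreover have "\<bar>(norm z)\<^sup>2 - 1\<bar> = (1 - norm v) * (norm z * (1 + norm z))"
    proof -
      have "1 < (norm z)\<^sup>2" using z1 by (simp add: one_less_power)
      moreover have "norm z \<noteq> 0" using z1 by linarith
      ultimately show ?thesis by (simp add: v field_simps power2_eq_square)
    qed
    ultimately have "norm (\<Phi> z) * \<bar>(norm z)\<^sup>2 - 1\<bar>
        = norm (G2 v * s v) * (1 - norm v) * (norm z * (1 + norm z))" by simp
    also have "\<dots> \<le> C2 * (2 * 3)"
      using C2[OF v(2)] z C2_0 by (intro mult_mono) auto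
    finally show ?thesis using C1_0 by simp
  qed

  \<comment> \<open>The points \<open>\<plusminus>\<i>\<close> are at distance 2, so the disk of
    radius 1 around one omits the other, and it stays within \<open>norm z \<le> 2\<close>, as
    \<open>growth\<close> requires. The radial path runs inside the unit disk, where
    \<open>\<Phi>\<close> is \<open>G1 * s\<close>.\<close>
  have bigo: "\<Phi> \<in> O[at p](\<lambda>_. 1)" if p: "p \<in> {\<i>, -\<i>}" for p
  proof (rule removable_of_circle_growth[where R = 1])
    show np: "norm p = 1" using p by auto
    have "norm (\<i> - (- \<i>)) = 2" by simp
    then have "- \<i> \<notin> ball \<i> 1" "\<i> \<notin> ball (-\<i>) 1"
      by (auto simp: dist_norm norm_minus_commute simp del: diff_minus_eq_add)
    then have sub: "ball p 1 - {p} \<subseteq> UNIV - {\<i>, -\<i>}"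
      using p by (auto simp del: mem_ball)
    show "\<Phi> holomorphic_on ball p 1 - {p}" by (rule holomorphic_on_subset[OF \<Phi> sub])
    show "norm (\<Phi> z) * \<bar>(norm z)\<^sup>2 - 1\<bar> \<le> 2 * C1 + 6 * C2" if "z \<in> ball p 1" "norm z \<noteq> 1" for z
    proof (rule growth)
      have "norm (z - p) < 1" using that by (simp add: dist_norm norm_minus_commute)
      then show "norm z \<le> 2" using norm_triangle_sub[of z p] np by linarith
    qed fact
    have "\<forall>\<^sub>F t in at_right (0::real). of_real t * (G1 (p * (1 - of_real t)) * s (p * (1 - of_real t)))
        = of_real t * \<Phi> (p * (1 - of_real t))"
      using eventually_at_right_real[OF zero_less_one]
    proof eventually_elim
      case (elim t)
      then have "norm (p * (1 - of_real t)) = 1 - t"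
        using np norm_of_real[of "1 - t", where ?'a = complex] by (simp add: norm_mult)
      then show ?case using elim by (simp add: \<Phi>_def)
    qed
    moreover have "((\<lambda>t. of_real t * (G1 (p * (1 - of_real t)) * s (p * (1 - of_real t)))) \<longlongrightarrow> 0) (at_right (0::real))"
      by (rule bergman_radial_limit[OF hs(1) I1[folded s_def] np])
    ultimately show "((\<lambda>t. of_real t * \<Phi> (p * (1 - of_real t))) \<longlongrightarrow> 0) (at_right (0::real))"
      by (rule Lim_transform_eventually[rotated])
  qed simp

  \<comment> \<open>This is \<open>\<Psi> 0\<close>, since the root of 1 is 1; it is the value of
    \<open>\<Phi>\<close> at infinity and therefore the constant in Liouville's theorem.\<close>
  define c where "c = cnj (G2 0)"
  have lim_\<Psi>: "(\<Psi> \<longlongrightarrow> c) (nhds 0)"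
    unfolding \<Psi>_def s_def c_def by (rule tendsto_csqrt_factor[OF G2])
  obtain g where g: "g holomorphic_on UNIV" "\<And>z. z \<notin> {\<i>, -\<i>} \<Longrightarrow> g z = \<Phi> z"
    using removable_singularities[of "{\<i>, -\<i>}" UNIV \<Phi>] \<Phi> bigo by auto
  have "(g \<longlongrightarrow> c) at_infinity"
  proof (rule Lim_transform_eventually)
    have "((\<lambda>z::complex. 1 / z) \<longlongrightarrow> 0) at_infinity"
      using tendsto_inverse_0[where 'a = complex] by (simp add: inverse_eq_divide[abs_def])
    then show "((\<lambda>z. \<Psi> (1 / z)) \<longlongrightarrow> c) at_infinity"
      by (rule filterlim_compose[OF lim_\<Psi>])
    show "\<forall>\<^sub>F z in at_infinity. \<Psi> (1 / z) = g z"
      unfolding eventually_at_infinity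
    proof (intro exI allI impI)
      fix z :: complex assume "norm z \<ge> 2"
      moreover from this have "z \<notin> {\<i>, -\<i>}" by auto
      ultimately show "\<Psi> (1 / z) = g z" by (simp add: g(2) \<Phi>_def)
    qed
  qed
  with g(1) have gc: "g z = c" for z by (rule Liouville_weak)
  have \<Phi>c: "\<Phi> z = c" if "z \<notin> {\<i>, -\<i>}" for z using g(2)[OF that] gc by simp
  have "G1 z * s z = c" if "norm z < 1" for z
  proof -
    have "z \<notin> {\<i>, -\<i>}" using that by auto
    from \<Phi>c[OF this] show ?thesis using that by (simp add: \<Phi>_def)
  qed
  moreover have "G2 z * s z = cnj c" if z: "norm z < 1" for z
  \<comment> \<open>The reflected point \<open>1 / cnj z\<close> exists only for nonzero
    \<open>z\<close>; at 0 the claim is the choice of \<open>c\<close>.\<close>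
  proof (cases "z = 0")
    case True
    then show ?thesis by (simp add: c_def s_def)
  next
    case False
    define w where "w = 1 / cnj z"
    have w: "norm w > 1" using z False by (simp add: w_def norm_divide less_divide_eq_1)
    then have "w \<notin> {\<i>, -\<i>}" by auto
    from \<Phi>c[OF this] have "\<Psi> (cnj z) = c" using w False by (simp add: \<Phi>_def w_def)
    moreover have "s (cnj z) = cnj (s z)"
      using cnj_csqrt[OF one_plus_square_notin_nonpos_Reals[of z]] z by (simp add: s_def)
    ultimately have "cnj (G2 z * s z) = c" by (simp add: \<Psi>_def)
    then show ?thesis by (metis complex_cnj_cnj)
  qed
  moreover have "H 1 * s 1 = c" using \<Phi>c[of 1] by (simp add: \<Phi>_def complex_eq_iff)
  moreover have "H (-1) * s (-1) = c" using \<Phi>c[of "-1"] by (simp add: \<Phi>_def complex_eq_iff)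
  ultimately show ?thesis by (auto simp: s_def)
qed

section \<open>Dilation products\<close>

text \<open>Substitute \<open>x / t\<close> for \<open>x\<close> and conjugate. The Jacobian is the
  absolute value of \<open>t\<close>, which is the source of the opposite signs on the two half
  lines.\<close>

lemma dilation_product_swap:
  assumes t: "t \<noteq> 0"
  shows "dilation_product f g t = cnj (dilation_product g f (1 / t)) / of_real \<bar>t\<bar>"
proof -
  have "dilation_product f g t = \<bar>1 / t\<bar> *\<^sub>R (\<integral>x. cnj (f (x / t)) * g x \<partial>lebesgue)"
    unfolding dilation_product_def
    using t lebesgue_integral_real_affine[of "1 / t" "\<lambda>x. cnj (f x) * g (t * x)" 0] by simp
  also have "(\<integral>x. cnj (f (x / t)) * g x \<partial>lebesgue) = (\<integral>x. cnj (cnj (g x) * f (1 / t * x)) \<partial>lebesgue)"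
    by (simp add: mult.commute)
  also have "\<dots> = cnj (dilation_product g f (1 / t))"
    unfolding dilation_product_def by (rule Bochner_Integration.integral_cnj)
  finally show ?thesis
    by (simp add: scaleR_conv_of_real divide_inverse)
qed

text \<open>The case in which \<open>F1\<close> is the function extended across the circle. The
  formula is read off from \<open>G1\<close> and \<open>G2\<close> for small \<open>t\<close>, from
  \<open>H\<close> at \<open>\<plusminus>1\<close>, and is carried to large \<open>t\<close> by the
  substitution \<open>t \<mapsto> 1 / t\<close>.\<close>

lemma dilation_products_of_extension:
  fixes f g :: "real \<Rightarrow> complex" and G1 G2 :: "complex \<Rightarrow> complex"
  defines "F1 \<equiv> dilation_product f g" and "F2 \<equiv> dilation_product g f"
  assumes G1: "holomorphic_extension F1 (ball 0 1) G1"
    and G2: "holomorphic_extension F2 (ball 0 1) G2"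
    and I1: "(\<integral>\<^sup>+z\<in>ball 0 1. ennreal ((norm (G1 z))\<^sup>2 * norm (z\<^sup>2 + 1)) \<partial>lborel) < \<infinity>"
    and I2: "(\<integral>\<^sup>+z\<in>ball 0 1. ennreal ((norm (G2 z))\<^sup>2 * norm (z\<^sup>2 + 1)) \<partial>lborel) < \<infinity>"
    and U: "cball 0 1 - {\<i>, - \<i>} \<subseteq> U" and H: "holomorphic_extension F1 U H"
  shows "\<exists>c. (\<forall>t. t \<noteq> 0 \<longrightarrow>
           F1 t = c * complex_of_real ((1 + t\<^sup>2) powr (- 1 / 2)) \<and>
           F2 t = cnj c * complex_of_real ((1 + t\<^sup>2) powr (- 1 / 2))) \<and>
         (c = 0 \<longrightarrow> (\<forall>z\<in>ball 0 1. G1 z = 0 \<and> G2 z = 0))"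
proof -
  note ext = G1[unfolded holomorphic_extension_def] G2[unfolded holomorphic_extension_def]
    H[unfolded holomorphic_extension_def]
  have swap: "F1 t = cnj (F2 (1 / t)) / of_real \<bar>t\<bar>" "F2 t = cnj (F1 (1 / t)) / of_real \<bar>t\<bar>"
    if "t \<noteq> 0" for t
    using dilation_product_swap[OF that] by (auto simp: F1_def F2_def)
  have real_U: "complex_of_real t \<in> U" if "\<bar>t\<bar> \<le> 1" for t
  proof -
    have "complex_of_real t \<noteq> \<i>" "complex_of_real t \<noteq> - \<i>" by (auto simp: complex_eq_iff)
    with that U show ?thesis by auto
  qed
  \<comment> \<open>The weight is the squared modulus of the root, so the hypotheses become plain
    square integrability of \<open>G1\<close> and \<open>G2\<close> times the root.\<close>
  have sq: "(norm (G z * csqrt (1 + z\<^sup>2)))\<^sup>2 = (norm (G z))\<^sup>2 * norm (z\<^sup>2 + 1)" for z and G :: "complex \<Rightarrow> complex"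
    by (simp add: norm_mult power_mult_distrib add.commute)
  have inv: "\<bar>1 / t\<bar> < 1" if "\<bar>t\<bar> > 1" for t :: real using that by (simp add: field_simps)
  have G1v: "G1 (of_real t) = F1 t" and G2v: "G2 (of_real t) = F2 t" if "t \<noteq> 0" "\<bar>t\<bar> < 1" for t
    using ext(1,2) that by simp_all
  have Hv: "H (of_real t) = F1 t" if "t \<noteq> 0" "of_real t \<in> U" for t
    using ext(3) that by simp
  have sub: "ball 0 1 \<subseteq> U" using U by auto
  have HG: "H z = G1 z" if "z \<in> ball 0 1" for z
  proof (rule holomorphic_eq_of_eq_on_reals[where f = H and g = G1 and S = "ball 0 1" and a = 0 and b = 1])
    show "H holomorphic_on ball 0 1" using ext sub by (auto intro: holomorphic_on_subset)
    fix x :: real assume "0 < x" "x < 1"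
    then show "complex_of_real x \<in> ball 0 1 \<and> H (of_real x) = G1 (of_real x)"
      using Hv[of x] G1v[of x] real_U[of x] by simp
  qed (use ext that in auto)
  have Hr: "H (of_real t) = cnj (G2 (1 / of_real t)) / of_real t" if "t > 1" "of_real t \<in> U" for t
  proof -
    have "G2 (of_real (1 / t)) = F2 (1 / t)" using inv[of t] that by (intro G2v) auto
    moreover have "H (of_real t) = F1 t" using that by (intro Hv) auto
    ultimately show ?thesis using swap(1)[of t] that by simp
  qed
  have Hl: "H (- of_real t) = cnj (G2 (- (1 / of_real t))) / of_real t" if "t > 1" "- of_real t \<in> U" for t
  proof -
    have "G2 (of_real (- (1 / t))) = F2 (- (1 / t))" using inv[of t] that by (intro G2v) auto
    moreover have "H (of_real (- t)) = F1 (- t)" using that by (intro Hv) auto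
    ultimately show ?thesis using swap(1)[of "- t"] that by simp
  qed
  have hol: "G1 holomorphic_on ball 0 1" "G2 holomorphic_on ball 0 1" "open U" "H holomorphic_on U"
    using ext by auto
  obtain c where "\<forall>z\<in>ball 0 1. G1 z * csqrt (1 + z\<^sup>2) = c \<and> G2 z * csqrt (1 + z\<^sup>2) = cnj c"
    and c_unit: "H 1 * csqrt 2 = c" "H (-1) * csqrt 2 = c"
    using constant_of_extension[OF hol(1,2) _ _ hol(3) U hol(4) HG Hr Hl] I1 I2
    unfolding sq by blast
  then have c: "G1 z * csqrt (1 + z\<^sup>2) = c" "G2 z * csqrt (1 + z\<^sup>2) = cnj c" if "z \<in> ball 0 1" for z
    using that by auto
  have csqrt_real: "csqrt (1 + (of_real t)\<^sup>2) = of_real (sqrt (1 + t\<^sup>2))" for t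
    using csqrt_of_real[of "1 + t\<^sup>2"] by simp
  have pos: "0 < 1 + t\<^sup>2" for t :: real by (simp add: add_pos_nonneg)
  have powr: "complex_of_real ((1 + t\<^sup>2) powr (- 1 / 2)) = 1 / of_real (sqrt (1 + t\<^sup>2))" for t
    using pos[of t] by (simp add: powr_minus_divide powr_half_sqrt)
  have small: "F1 t = c / of_real (sqrt (1 + t\<^sup>2))" "F2 t = cnj c / of_real (sqrt (1 + t\<^sup>2))"
    if t: "t \<noteq> 0" "\<bar>t\<bar> < 1" for t
  proof -
    have "G1 (of_real t) = F1 t" "G2 (of_real t) = F2 t" using G1v G2v t by blast+
    moreover have "complex_of_real (sqrt (1 + t\<^sup>2)) \<noteq> 0" using pos[of t] by simp
    ultimately show "F1 t = c / of_real (sqrt (1 + t\<^sup>2))" "F2 t = cnj c / of_real (sqrt (1 + t\<^sup>2))"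
      using c[of "of_real t"] t by (auto simp: csqrt_real field_simps)
  qed
  \<comment> \<open>At \<open>\<plusminus>1\<close> the extension \<open>H\<close> supplies
    \<open>F1\<close>; the value of \<open>F2\<close> follows later from \<open>swap\<close>,
    because \<open>1 / t = t\<close> there.\<close>
  have F1_unit: "F1 t = c / of_real (sqrt (1 + t\<^sup>2))" if t: "\<bar>t\<bar> = 1" for t
  proof -
    have "H (of_real t) = F1 t" using real_U[of t] t by (intro Hv) auto
    moreover have "H (of_real t) * csqrt 2 = c" using c_unit t by (auto simp: abs_if split: if_splits)
    moreover have "t\<^sup>2 = 1" using t by (metis power2_abs one_power2)
    ultimately show ?thesis by (auto simp: field_simps)
  qed
  \<comment> \<open>This identity makes the formula for \<open>F1\<close> and \<open>F2\<close>
    compatible with \<open>swap\<close>.\<close>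
  have large: "sqrt (1 + (1 / t)\<^sup>2) * \<bar>t\<bar> = sqrt (1 + t\<^sup>2)" if "t \<noteq> 0" for t :: real
  proof -
    have "sqrt (1 + (1 / t)\<^sup>2) * sqrt (t\<^sup>2) = sqrt ((1 + (1 / t)\<^sup>2) * t\<^sup>2)"
      by (simp only: real_sqrt_mult)
    also have "(1 + (1 / t)\<^sup>2) * t\<^sup>2 = 1 + t\<^sup>2" using that by (simp add: field_simps)
    finally show ?thesis by simp
  qed
  have F12: "F1 t = c / of_real (sqrt (1 + t\<^sup>2)) \<and> F2 t = cnj c / of_real (sqrt (1 + t\<^sup>2))"
    if t: "t \<noteq> 0" for t
  proof -
    consider "\<bar>t\<bar> < 1" | "\<bar>t\<bar> = 1" | "\<bar>t\<bar> > 1" by linarith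
    then show ?thesis
    proof cases
      case 1
      with small t show ?thesis by blast
    next
      case 2
      then have "1 / t = t" by (auto simp: abs_if split: if_splits)
      with swap(2)[OF t] F1_unit[OF 2] 2 show ?thesis by simp
    next
      case 3
      have r: "complex_of_real (sqrt (1 + (1 / t)\<^sup>2)) * of_real \<bar>t\<bar> = of_real (sqrt (1 + t\<^sup>2))"
        using large[OF t] by (simp flip: of_real_mult)
      from swap[OF t] small[of "1 / t"] inv[OF 3] t
      have "F1 t = c / (complex_of_real (sqrt (1 + (1 / t)\<^sup>2)) * of_real \<bar>t\<bar>)"
        "F2 t = cnj c / (complex_of_real (sqrt (1 + (1 / t)\<^sup>2)) * of_real \<bar>t\<bar>)" by simp_all
      then show ?thesis unfolding r by simp
    qed
  qed
  \<comment> \<open>The root has no zero in the disk, because 0 is one of the values excluded for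
    \<open>1 + z\<^sup>2\<close>.\<close>
  have "G1 z = 0 \<and> G2 z = 0" if "c = 0" "z \<in> ball 0 1" for z
    using c[OF that(2)] that one_plus_square_notin_nonpos_Reals[of z] by auto
  then show ?thesis
    unfolding powr using F12 by (intro exI[of _ c]) auto
qed

theorem theorem4p1:
  fixes f g :: "real \<Rightarrow> complex"
    and F1 F2 :: "real \<Rightarrow> complex"
    and G1 G2 :: "complex \<Rightarrow> complex"
  assumes "square_integrable f" and "square_integrable g"
    and "F1 = dilation_product f g" and "F2 = dilation_product g f"
    and "holomorphic_extension F1 (ball 0 1) G1"
    and "holomorphic_extension F2 (ball 0 1) G2"
    and "(\<integral>\<^sup>+z\<in>ball 0 1. ennreal ((norm (G1 z))\<^sup>2 * norm (z\<^sup>2 + 1)) \<partial>lborel) < \<infinity>"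
    and "(\<integral>\<^sup>+z\<in>ball 0 1. ennreal ((norm (G2 z))\<^sup>2 * norm (z\<^sup>2 + 1)) \<partial>lborel) < \<infinity>"
    and "(\<exists>U H. cball 0 1 - {\<i>, - \<i>} \<subseteq> U \<and> holomorphic_extension F1 U H) \<or>
         (\<exists>U H. cball 0 1 - {\<i>, - \<i>} \<subseteq> U \<and> holomorphic_extension F2 U H)"
  shows "\<exists>c1 c2. c2 = cnj c1 \<and>
           (\<forall>t. t \<noteq> 0 \<longrightarrow>
              F1 t = c1 * complex_of_real ((1 + t\<^sup>2) powr (- 1 / 2)) \<and>
              F2 t = c2 * complex_of_real ((1 + t\<^sup>2) powr (- 1 / 2))) \<and>
           (c1 = 0 \<longrightarrow>
              (\<forall>t. t \<noteq> 0 \<longrightarrow> F1 t = 0 \<and> F2 t = 0) \<and>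
              (\<forall>z\<in>ball 0 1. G1 z = 0 \<and> G2 z = 0))"
  using assms(9)
proof (elim disjE exE conjE)
  fix U H
  assume U: "cball 0 1 - {\<i>, - \<i>} \<subseteq> U" and H: "holomorphic_extension F1 U H"
  from dilation_products_of_extension[OF assms(5,6)[unfolded assms(3,4)] assms(7,8) U H[unfolded assms(3)]]
  obtain c where "\<And>t. t \<noteq> 0 \<Longrightarrow> F1 t = c * complex_of_real ((1 + t\<^sup>2) powr (- 1 / 2)) \<and>
      F2 t = cnj c * complex_of_real ((1 + t\<^sup>2) powr (- 1 / 2))"
    "c = 0 \<Longrightarrow> \<forall>z\<in>ball 0 1. G1 z = 0 \<and> G2 z = 0"
    unfolding assms(3,4) by blast
  then show ?thesis by (intro exI[of _ c] exI[of _ "cnj c"]) auto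
next
  fix U H
  assume U: "cball 0 1 - {\<i>, - \<i>} \<subseteq> U" and H: "holomorphic_extension F2 U H"
  from dilation_products_of_extension[OF assms(6,5)[unfolded assms(3,4)] assms(8,7) U H[unfolded assms(4)]]
  obtain c where "\<And>t. t \<noteq> 0 \<Longrightarrow> F2 t = c * complex_of_real ((1 + t\<^sup>2) powr (- 1 / 2)) \<and>
      F1 t = cnj c * complex_of_real ((1 + t\<^sup>2) powr (- 1 / 2))"
    "c = 0 \<Longrightarrow> \<forall>z\<in>ball 0 1. G2 z = 0 \<and> G1 z = 0"
    unfolding assms(3,4) by blast
  \<comment> \<open>The roles of \<open>F1\<close> and \<open>F2\<close> were exchanged, so
    \<open>c\<close> belongs to \<open>F2\<close> and its conjugate to \<open>F1\<close>.\<close>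
  then show ?thesis by (intro exI[of _ "cnj c"] exI[of _ c]) auto
qed

end
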